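(* Let $n\ge1$ and $d\ge1$ be integers. Every $d$-maximal set $S\subset[n]^\infty$ has at least $\tfrac12\,(d/\log 2d)^{2/3}$ elements.
   Context: $[n]=\{1,\dots,n\}$, $[n]^\infty$ is the set of infinite sequences over $[n]$, $\mathrm{dist}(a,b)=|\{i:a_i\ne b_i\}|$ is the Hamming distance, $\mathrm{diam}(S)=\sup_{a,b\in S}\mathrm{dist}(a,b)$. $S$ is $d$-maximal if $\mathrm{diam}(S)=d$ and $S$ is inclusion-maximal among subsets of $[n]^\infty$ of diameter $d$. $\log$ denotes the natural logarithm. *)

theory Defs
  imports Complex_Main "HOL-Library.Extended_Nat"
begin

definition seqs :: "nat \<Rightarrow> (nat \<Rightarrow> nat) set" where
  "seqs n = {a. \<forall>i. a i \<in> {1..n}}"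

definition hdist :: "(nat \<Rightarrow> nat) \<Rightarrow> (nat \<Rightarrow> nat) \<Rightarrow> enat" where
  "hdist a b = (if finite {i. a i \<noteq> b i} then enat (card {i. a i \<noteq> b i}) else \<infinity>)"

definition hdiam :: "(nat \<Rightarrow> nat) set \<Rightarrow> enat" where
  "hdiam S = (SUP (a, b) \<in> S \<times> S. hdist a b)"

definition d_maximal :: "nat \<Rightarrow> nat \<Rightarrow> (nat \<Rightarrow> nat) set \<Rightarrow> bool" where
  "d_maximal n d S \<longleftrightarrow>
     S \<subseteq> seqs n \<and> hdiam S = enat d \<and>
     (\<forall>T. T \<subseteq> seqs n \<and> hdiam T = enat d \<and> S \<subseteq> T \<longrightarrow> T = S)"

end

theory Submission
  imports Defs
begin

text \<open>
  Let \<open>S\<close> be finite with \<open>m\<close> elements. By maximality no point is at distance less than \<open>d\<close> from all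
  of \<open>S\<close>. Letting every coordinate be that of an independent uniform element of \<open>S\<close> gives a random
  point at mean distance at most \<open>d - d / m\<close> from each element. These \<open>m\<close> means are linear in the
  coordinate distributions, so a basic solution attains the same means with at most \<open>m\<close> coordinates
  still random. Rounding those independently deviates by order \<open>sqrt (m ln m)\<close>, which must then be at
  least of order \<open>d / m\<close>.
\<close>

section \<open>Linear systems and solutions of small support\<close>

text \<open>Gaussian elimination, by induction on the equations: a pivot variable \<open>p\<close>
  of the equation \<open>e\<close> is eliminated from the others, which costs one equation and one
  variable and so preserves the strict inequality.\<close>

lemma homogeneous_solution_exists:
  fixes a :: "'e \<Rightarrow> 'v \<Rightarrow> real"
  assumes "finite E" "finite V" "card E < card V"
  shows "\<exists>u. (\<exists>v\<in>V. u v \<noteq> 0) \<and> (\<forall>e\<in>E. (\<Sum>v\<in>V. a e v * u v) = 0)"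
  using assms
proof (induction E arbitrary: V a rule: finite_induct)
  case empty
  then obtain v where "v \<in> V" by fastforce
  then show ?case by (intro exI[of _ "\<lambda>_. 1"]) auto
next
  case (insert e E)
  show ?case
  proof (cases "\<forall>v\<in>V. a e v = 0")
    case True
    have "card E < card V" using insert by simp
    from insert.IH[OF insert.prems(1) this, of a] obtain u where
      "\<exists>v\<in>V. u v \<noteq> 0" "\<forall>e\<in>E. (\<Sum>v\<in>V. a e v * u v) = 0" by blast
    with True show ?thesis by (intro exI[of _ u]) auto
  next
    case False
    then obtain p where p: "p \<in> V" "a e p \<noteq> 0" by blast
    define W where "W = V - {p}"
    have W: "finite W" "card E < card W" "p \<notin> W" "V = insert p W"
      using insert p by (auto simp: W_def card_Diff_singleton)
    \<comment> \<open>The coefficients are those of \<open>e'\<close> minus the multiple of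
      \<open>e\<close> that cancels the coefficient of \<open>p\<close>.\<close>
    from insert.IH[OF W(1,2), of "\<lambda>e' v. a e' v - a e' p / a e p * a e v"] obtain u where
      u: "\<exists>v\<in>W. u v \<noteq> 0"
         "\<forall>e'\<in>E. (\<Sum>v\<in>W. (a e' v - a e' p / a e p * a e v) * u v) = 0" by blast
    \<comment> \<open>The value of \<open>p\<close> is forced by equation \<open>e\<close>.\<close>
    define x where "x = - (\<Sum>v\<in>W. a e v * u v) / a e p"
    have sum_eq: "(\<Sum>v\<in>V. a e' v * (u(p := x)) v) = a e' p * x + (\<Sum>v\<in>W. a e' v * u v)" for e'
    proof -
      have "(\<Sum>v\<in>W. a e' v * (u(p := x)) v) = (\<Sum>v\<in>W. a e' v * u v)"
        using W(3) by (intro sum.cong) auto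
      then show ?thesis using W by simp
    qed
    have "(\<Sum>v\<in>V. a e' v * (u(p := x)) v) = 0" if "e' \<in> insert e E" for e'
    proof (cases "e' = e")
      case True
      then show ?thesis unfolding sum_eq unfolding x_def using p by simp
    next
      case False
      with that u(2) have "(\<Sum>v\<in>W. (a e' v - a e' p / a e p * a e v) * u v) = 0" by blast
      moreover have "(\<Sum>v\<in>W. (a e' v - a e' p / a e p * a e v) * u v)
          = (\<Sum>v\<in>W. a e' v * u v) - a e' p / a e p * (\<Sum>v\<in>W. a e v * u v)"
        by (simp add: sum_distrib_left sum_subtractf left_diff_distrib mult.assoc)
      ultimately show ?thesis unfolding sum_eq unfolding x_def by simp
    qed
    moreover have "\<exists>v\<in>V. (u(p := x)) v \<noteq> 0" using u(1) W by auto
    ultimately show ?thesis by blast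
  qed
qed

text \<open>The Caratheodory argument: as long as the support has more elements than there are
  equations, some nonzero kernel vector lives on it. Moving along that vector until a first
  coordinate reaches 0 keeps all equations and shrinks the support.\<close>

lemma sparse_nonneg_solution:
  fixes a :: "'e \<Rightarrow> 'v \<Rightarrow> real" and w :: "'v \<Rightarrow> real"
  assumes "finite E" "finite V" "\<And>v. v \<in> V \<Longrightarrow> w v \<ge> 0"
  shows "\<exists>w'. (\<forall>v\<in>V. w' v \<ge> 0) \<and> (\<forall>e\<in>E. (\<Sum>v\<in>V. a e v * w' v) = (\<Sum>v\<in>V. a e v * w v))
     \<and> card {v\<in>V. w' v \<noteq> 0} \<le> card E"
  using assms(3)
proof (induction "card {v\<in>V. w v \<noteq> 0}" arbitrary: w rule: less_induct)
  case less
  define W where "W = {v\<in>V. w v \<noteq> 0}"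
  have finW: "finite W" using assms by (simp add: W_def)
  show ?case
  proof (cases "card W \<le> card E")
    case True
    then show ?thesis using less.prems by (intro exI[of _ w]) (auto simp: W_def)
  next
    case False
    then obtain u0 where u0: "\<exists>v\<in>W. u0 v \<noteq> 0" "\<forall>e\<in>E. (\<Sum>v\<in>W. a e v * u0 v) = 0"
      using homogeneous_solution_exists[OF assms(1) finW, of a] by auto
    \<comment> \<open>A negative entry is what stops the motion in direction \<open>u\<close>; if
      \<open>u0\<close> has none, then \<open>- u0\<close> does.\<close>
    obtain u where u: "\<exists>v\<in>W. u v < 0" "\<forall>e\<in>E. (\<Sum>v\<in>W. a e v * u v) = 0"
    proof (cases "\<exists>v\<in>W. u0 v < 0")
      case True
      then show ?thesis using that u0 by blast
    next
      case False
      with u0(1) have "\<exists>v\<in>W. - u0 v < 0" by force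
      moreover have "\<forall>e\<in>E. (\<Sum>v\<in>W. a e v * - u0 v) = 0" using u0(2) by (simp add: sum_negf)
      ultimately show ?thesis using that[of "\<lambda>v. - u0 v"] by blast
    qed
    define N where "N = {v\<in>W. u v < 0}"
    have N: "finite N" "N \<noteq> {}" using finW u by (auto simp: N_def)
    \<comment> \<open>The largest step that keeps \<open>w + t * u\<close> nonnegative; the
      minimiser \<open>q\<close> is the coordinate that becomes 0.\<close>
    define t where "t = Min ((\<lambda>v. w v / - u v) ` N)"
    have "t \<in> (\<lambda>v. w v / - u v) ` N" unfolding t_def using N by (intro Min_in) auto
    then obtain q where q: "q \<in> N" "t = w q / - u q" by blast
    have t_le: "t \<le> w v / - u v" if "v \<in> N" for v
      unfolding t_def using N that by (intro Min_le) auto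
    have wpos: "w v > 0" if "v \<in> W" for v
      using that less.prems[of v] by (auto simp: W_def)
    have tpos: "t \<ge> 0" using q wpos[of q] by (auto simp: N_def divide_le_0_iff)
    define w' where "w' = (\<lambda>v. if v \<in> W then w v + t * u v else w v)"
    have nonneg: "w' v \<ge> 0" if "v \<in> V" for v
    proof (cases "v \<in> N")
      case True
      then have "u v < 0" by (simp add: N_def)
      with t_le[OF True] have "t * - u v \<le> w v" using pos_le_divide_eq[of "- u v" t "w v"] by linarith
      then show ?thesis using less.prems[OF that] by (simp add: w'_def)
    next
      case False
      then show ?thesis using less.prems[OF that] tpos by (auto simp: w'_def N_def)
    qed
    have "w' q = 0" "q \<in> W" using q by (auto simp: w'_def N_def)
    then have "{v\<in>V. w' v \<noteq> 0} \<subseteq> W - {q}" by (auto simp: w'_def W_def)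
    then have "card {v\<in>V. w' v \<noteq> 0} \<le> card (W - {q})" using finW by (intro card_mono) auto
    also have "\<dots> < card W" using finW \<open>q \<in> W\<close> by (rule card_Diff1_less)
    finally have "card {v\<in>V. w' v \<noteq> 0} < card {v\<in>V. w v \<noteq> 0}" by (simp add: W_def)
    from less.hyps[OF this nonneg] obtain w'' where w'': "\<forall>v\<in>V. w'' v \<ge> 0"
      "\<forall>e\<in>E. (\<Sum>v\<in>V. a e v * w'' v) = (\<Sum>v\<in>V. a e v * w' v)"
      "card {v\<in>V. w'' v \<noteq> 0} \<le> card E" by blast
    have "(\<Sum>v\<in>V. a e v * w' v) = (\<Sum>v\<in>V. a e v * w v)" if "e \<in> E" for e
    proof -
      have "(\<Sum>v\<in>V. a e v * w' v) = (\<Sum>v\<in>V. a e v * w v + (if v \<in> W then t * (a e v * u v) else 0))"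
        by (intro sum.cong) (auto simp: w'_def algebra_simps)
      also have "\<dots> = (\<Sum>v\<in>V. a e v * w v) + (\<Sum>v\<in>V \<inter> W. t * (a e v * u v))"
        using assms(2) by (simp add: sum.distrib sum.inter_restrict)
      also have "V \<inter> W = W" by (auto simp: W_def)
      also have "(\<Sum>v\<in>W. t * (a e v * u v)) = 0" using u(2) that by (simp flip: sum_distrib_left)
      finally show ?thesis by simp
    qed
    with w'' show ?thesis by (intro exI[of _ w'']) auto
  qed
qed

text \<open>There are \<open>card I + card K\<close> equations, hence a solution with at most that
  many nonzero entries. Every row needs one nonzero entry, and a row without an entry 1 needs two,
  so at most \<open>card K\<close> rows are of the latter type.\<close>

lemma sparse_randomisation:
  fixes w :: "'i \<Rightarrow> 'j \<Rightarrow> real" and c :: "'k \<Rightarrow> 'i \<Rightarrow> 'j \<Rightarrow> real"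
  assumes fin: "finite I" "finite J" "finite K"
    and nonneg: "\<And>i j. i \<in> I \<Longrightarrow> j \<in> J \<Longrightarrow> w i j \<ge> 0"
    and total: "\<And>i. i \<in> I \<Longrightarrow> (\<Sum>j\<in>J. w i j) = 1"
  obtains w' where "\<And>i j. i \<in> I \<Longrightarrow> j \<in> J \<Longrightarrow> w' i j \<ge> 0"
    and "\<And>i. i \<in> I \<Longrightarrow> (\<Sum>j\<in>J. w' i j) = 1"
    and "\<And>k. k \<in> K \<Longrightarrow> (\<Sum>i\<in>I. \<Sum>j\<in>J. c k i j * w' i j) = (\<Sum>i\<in>I. \<Sum>j\<in>J. c k i j * w i j)"
    and "card {i\<in>I. \<forall>j\<in>J. w' i j \<noteq> 1} \<le> card K"
proof -
  \<comment> \<open>One system for both kinds of constraint: \<open>Inl\<close> equations fix the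
    row sums, \<open>Inr\<close> equations fix the costs.\<close>
  define a where "a = (\<lambda>e (i, j). case e of Inl i' \<Rightarrow> of_bool (i = i') | Inr k \<Rightarrow> c k i j)"
  have "\<exists>w'. (\<forall>v\<in>I \<times> J. w' v \<ge> 0) \<and>
      (\<forall>e\<in>I <+> K. (\<Sum>v\<in>I \<times> J. a e v * w' v) = (\<Sum>v\<in>I \<times> J. a e v * case_prod w v))
      \<and> card {v\<in>I \<times> J. w' v \<noteq> 0} \<le> card (I <+> K)"
    by (rule sparse_nonneg_solution) (use fin nonneg in auto)
  then obtain u where u: "\<forall>v\<in>I \<times> J. u v \<ge> 0"
    "\<forall>e\<in>I <+> K. (\<Sum>v\<in>I \<times> J. a e v * u v) = (\<Sum>v\<in>I \<times> J. a e v * case_prod w v)"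
    "card {v\<in>I \<times> J. u v \<noteq> 0} \<le> card (I <+> K)" by blast
  define w' where "w' = curry u"
  have row: "(\<Sum>v\<in>I \<times> J. a (Inl i) v * g v) = (\<Sum>j\<in>J. g (i, j))" if "i \<in> I" for i g
  proof -
    have "(\<Sum>v\<in>I \<times> J. a (Inl i) v * g v) = (\<Sum>i'\<in>I. \<Sum>j\<in>J. of_bool (i' = i) * g (i', j))"
      by (simp add: a_def sum.cartesian_product case_prod_unfold)
    also have "\<dots> = (\<Sum>i'\<in>I. if i' = i then \<Sum>j\<in>J. g (i', j) else 0)"
      by (intro sum.cong) auto
    also have "\<dots> = (\<Sum>j\<in>J. g (i, j))" using that fin by simp
    finally show ?thesis .
  qed
  have col: "(\<Sum>v\<in>I \<times> J. a (Inr k) v * g v) = (\<Sum>i\<in>I. \<Sum>j\<in>J. c k i j * g (i, j))" for k g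
    by (simp add: a_def sum.cartesian_product case_prod_unfold)
  have nonneg': "w' i j \<ge> 0" if "i \<in> I" "j \<in> J" for i j using u(1) that by (auto simp: w'_def)
  have total': "(\<Sum>j\<in>J. w' i j) = 1" if "i \<in> I" for i
  proof -
    have "(\<Sum>j\<in>J. u (i, j)) = (\<Sum>j\<in>J. w i j)"
      using u(2)[rule_format, of "Inl i"] that by (simp add: row InlI)
    then show ?thesis using total that by (simp add: w'_def)
  qed
  have cost': "(\<Sum>i\<in>I. \<Sum>j\<in>J. c k i j * w' i j) = (\<Sum>i\<in>I. \<Sum>j\<in>J. c k i j * w i j)" if "k \<in> K" for k
    using u(2)[rule_format, of "Inr k"] that by (simp add: col InrI w'_def)
  define F where "F = {i\<in>I. \<forall>j\<in>J. w' i j \<noteq> 1}"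
  define supp where "supp = (\<lambda>i. {j\<in>J. w' i j \<noteq> 0})"
  have supp_fin: "finite (supp i)" for i using fin by (simp add: supp_def)
  have supp_sum: "(\<Sum>j\<in>supp i. w' i j) = 1" if "i \<in> I" for i
    using total'[OF that] fin
    by (subst sum.mono_neutral_left[of J]) (auto simp: supp_def)
  \<comment> \<open>A single nonzero entry in a row of sum 1 equals 1, which is excluded for rows in
    \<open>F\<close>.\<close>
  have supp_card: "1 + of_bool (i \<in> F) \<le> card (supp i)" if "i \<in> I" for i
  proof (rule ccontr)
    assume less: "\<not> ?thesis"
    have "card (supp i) \<noteq> 0" using supp_sum[OF that] supp_fin[of i] by auto
    with less have "i \<in> F" "card (supp i) = 1" by (cases "i \<in> F"; simp)+
    then obtain j where j: "supp i = {j}" using card_1_singletonE by blast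
    then have "j \<in> J" by (auto simp: supp_def)
    moreover have "w' i j = 1" using supp_sum[OF that] j by simp
    ultimately show False using \<open>i \<in> F\<close> by (auto simp: F_def)
  qed
  have "card I + card F = (\<Sum>i\<in>I. 1 + of_bool (i \<in> F))"
  proof -
    have "(\<Sum>i\<in>I. of_bool (i \<in> F)) = (card (I \<inter> F) :: nat)" using fin by (simp add: Int_def)
    moreover have "I \<inter> F = F" by (auto simp: F_def)
    ultimately show ?thesis by (simp only: sum.distrib) simp
  qed
  also have "\<dots> \<le> (\<Sum>i\<in>I. card (supp i))" using supp_card by (intro sum_mono) auto
  also have "\<dots> = card (Sigma I supp)" using fin supp_fin by simp
  also have "Sigma I supp = {v\<in>I \<times> J. u v \<noteq> 0}" by (auto simp: supp_def w'_def)
  also have "card \<dots> \<le> card I + card K" using u(3) fin by (simp add: card_Plus)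
  finally have "card F \<le> card K" by simp
  then show ?thesis using that[of w'] nonneg' total' cost' by (simp add: F_def)
qed

section \<open>Exponential moments and rounding\<close>

text \<open>Made for averaging over a centred variable: the linear term drops out and only the
  quadratic exponential is left.\<close>

lemma exp_le_self_plus_exp_square: "exp x \<le> x + exp (x\<^sup>2)" for x :: real
proof -
  have sq: "1 + x\<^sup>2 \<le> exp (x\<^sup>2)" by (rule exp_ge_add_one_self)
  consider "x \<le> 0" | "0 \<le> x" "x \<le> 1" | "x > 1" by linarith
  then show ?thesis
  proof cases
    case 1
    \<comment> \<open>The product is \<open>1 - x^3\<close>.\<close>
    have "1 \<le> (1 + x + x\<^sup>2) * (1 - x)"
      using 1 mult_nonpos_nonneg[of x "x * x"] by (simp add: algebra_simps power2_eq_square)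
    also have "\<dots> \<le> (1 + x + x\<^sup>2) * exp (- x)"
    proof (rule mult_left_mono)
      show "1 - x \<le> exp (- x)" using exp_ge_add_one_self[of "- x"] by simp
      have "0 \<le> (x + 1/2)\<^sup>2" by simp
      then show "0 \<le> 1 + x + x\<^sup>2" by (simp add: power2_eq_square algebra_simps)
    qed
    finally have "exp x \<le> 1 + x + x\<^sup>2" by (simp add: exp_minus field_simps)
    then show ?thesis using sq by linarith
  next
    case 2
    then show ?thesis using exp_bound[of x] sq by linarith
  next
    case 3
    then have "x \<le> x\<^sup>2" by (simp add: power2_eq_square)
    then have "exp x \<le> exp (x\<^sup>2)" by simp
    then show ?thesis using 3 by linarith
  qed
qed

text \<open>A form of Hoeffding's lemma with a weaker constant. The mean \<open>p\<close> lies
  between 0 and 1, so deviations from it are at most 1 in absolute value, and the linear term of the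
  preceding inequality averages to 0.\<close>

lemma centred_exp_mean_le:
  fixes w c :: "'j \<Rightarrow> real" and l :: real
  assumes "finite J" and nonneg: "\<And>j. j \<in> J \<Longrightarrow> w j \<ge> 0" and total: "(\<Sum>j\<in>J. w j) = 1"
    and c: "\<And>j. j \<in> J \<Longrightarrow> 0 \<le> c j \<and> c j \<le> 1"
  shows "(\<Sum>j\<in>J. w j * exp (l * (c j - (\<Sum>j\<in>J. c j * w j)))) \<le> exp (l\<^sup>2)"
proof -
  define p where "p = (\<Sum>j\<in>J. c j * w j)"
  have p0: "0 \<le> p" unfolding p_def using nonneg c by (intro sum_nonneg) auto
  have "p \<le> (\<Sum>j\<in>J. 1 * w j)" unfolding p_def using nonneg c by (intro sum_mono mult_right_mono) auto
  then have p1: "p \<le> 1" using total by simp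
  have "(\<Sum>j\<in>J. w j * exp (l * (c j - p))) \<le> (\<Sum>j\<in>J. w j * (l * (c j - p) + exp (l\<^sup>2)))"
  proof (intro sum_mono mult_left_mono nonneg)
    fix j assume j: "j \<in> J"
    have "(c j - p)\<^sup>2 \<le> 1" using c[OF j] p0 p1 by (simp add: abs_square_le_1 abs_le_iff)
    then have "(l * (c j - p))\<^sup>2 \<le> l\<^sup>2"
      by (simp add: power_mult_distrib mult_left_le)
    then have "exp ((l * (c j - p))\<^sup>2) \<le> exp (l\<^sup>2)" by simp
    then show "exp (l * (c j - p)) \<le> l * (c j - p) + exp (l\<^sup>2)"
      using exp_le_self_plus_exp_square[of "l * (c j - p)"] by linarith
  qed
  also have "\<dots> = l * ((\<Sum>j\<in>J. c j * w j) - p * (\<Sum>j\<in>J. w j)) + exp (l\<^sup>2) * (\<Sum>j\<in>J. w j)"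
    by (simp add: sum_distrib_left sum_distrib_right sum.distrib sum_subtractf algebra_simps)
  also have "\<dots> = exp (l\<^sup>2)" by (simp add: total p_def)
  finally show ?thesis by (simp add: p_def)
qed

lemma weighted_average_witness:
  fixes w g :: "'j \<Rightarrow> real"
  assumes "finite J" and nonneg: "\<And>j. j \<in> J \<Longrightarrow> w j \<ge> 0" and total: "(\<Sum>j\<in>J. w j) = 1"
  shows "\<exists>j\<in>J. g j \<le> (\<Sum>j\<in>J. w j * g j)"
proof (rule ccontr)
  assume "\<not> ?thesis"
  then have gt: "\<And>j. j \<in> J \<Longrightarrow> (\<Sum>j\<in>J. w j * g j) < g j" by force
  obtain j where j: "j \<in> J" "w j > 0"
    using total nonneg by (metis sum.neutral zero_neq_one order_less_le)
  define B where "B = (\<Sum>j\<in>J. w j * g j)"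
  have "(\<Sum>j\<in>J. w j * B) < (\<Sum>j\<in>J. w j * g j)"
  proof (rule sum_strict_mono_ex1[OF assms(1)])
    show "\<forall>j\<in>J. w j * B \<le> w j * g j"
      using gt nonneg by (auto simp: B_def intro!: mult_left_mono intro: less_imp_le)
    show "\<exists>j\<in>J. w j * B < w j * g j"
      using gt j by (auto simp: B_def intro!: bexI[of _ j])
  qed
  then show False using total by (simp add: B_def flip: sum_distrib_right)
qed

text \<open>Method of conditional expectations: some value of each new coordinate does no worse than
  the average over its distribution.\<close>

lemma derandomised_exp_moment:
  fixes w :: "'i \<Rightarrow> 'j \<Rightarrow> real" and c :: "'k \<Rightarrow> 'i \<Rightarrow> 'j \<Rightarrow> real" and l :: real
  assumes "finite F" "finite J" "finite K"
    and "\<And>i j. i \<in> F \<Longrightarrow> j \<in> J \<Longrightarrow> w i j \<ge> 0"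
    and "\<And>i. i \<in> F \<Longrightarrow> (\<Sum>j\<in>J. w i j) = 1"
    and "\<And>k i j. k \<in> K \<Longrightarrow> i \<in> F \<Longrightarrow> j \<in> J \<Longrightarrow> 0 \<le> c k i j \<and> c k i j \<le> 1"
  shows "\<exists>f. (\<forall>i\<in>F. f i \<in> J) \<and>
    (\<Sum>k\<in>K. exp (l * (\<Sum>i\<in>F. c k i (f i) - (\<Sum>j\<in>J. c k i j * w i j)))) \<le> card K * exp (l\<^sup>2 * card F)"
  using assms(1,4-6)
proof (induction F rule: finite_induct)
  case empty
  then show ?case by simp
next
  case (insert x F)
  define p where "p = (\<lambda>k i. \<Sum>j\<in>J. c k i j * w i j)"
  obtain f where f: "\<forall>i\<in>F. f i \<in> J"
    "(\<Sum>k\<in>K. exp (l * (\<Sum>i\<in>F. c k i (f i) - p k i))) \<le> card K * exp (l\<^sup>2 * card F)"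
    using insert.IH insert.prems unfolding p_def by auto
  \<comment> \<open>The weight that the coordinates already fixed give to \<open>k\<close>; the new
    coordinate multiplies it by one further factor, whose mean is at most
    \<open>exp (l\<^sup>2)\<close>.\<close>
  define A where "A = (\<lambda>k. exp (l * (\<Sum>i\<in>F. c k i (f i) - p k i)))"
  obtain j where j: "j \<in> J"
    "(\<Sum>k\<in>K. A k * exp (l * (c k x j - p k x)))
       \<le> (\<Sum>j\<in>J. w x j * (\<Sum>k\<in>K. A k * exp (l * (c k x j - p k x))))"
    using weighted_average_witness[OF assms(2), of "w x"
        "\<lambda>j. \<Sum>k\<in>K. A k * exp (l * (c k x j - p k x))"] insert.prems by blast
  have upd: "(\<Sum>i\<in>insert x F. c k i ((f(x := j)) i) - p k i)
      = (c k x j - p k x) + (\<Sum>i\<in>F. c k i (f i) - p k i)" for k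
  proof -
    have "(\<Sum>i\<in>F. c k i ((f(x := j)) i) - p k i) = (\<Sum>i\<in>F. c k i (f i) - p k i)"
      using insert.hyps by (intro sum.cong) auto
    then show ?thesis using insert.hyps by simp
  qed
  have "(\<Sum>k\<in>K. exp (l * (\<Sum>i\<in>insert x F. c k i ((f(x := j)) i) - p k i)))
      = (\<Sum>k\<in>K. A k * exp (l * (c k x j - p k x)))"
    unfolding upd by (simp add: A_def distrib_left exp_add mult.commute)
  also note j(2)
  also have "(\<Sum>j\<in>J. w x j * (\<Sum>k\<in>K. A k * exp (l * (c k x j - p k x))))
      = (\<Sum>k\<in>K. A k * (\<Sum>j\<in>J. w x j * exp (l * (c k x j - p k x))))"
    by (simp only: sum_distrib_left) (subst sum.swap, simp add: mult_ac)
  also have "\<dots> \<le> (\<Sum>k\<in>K. A k * exp (l\<^sup>2))"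
  proof (intro sum_mono mult_left_mono)
    fix k assume "k \<in> K"
    then show "(\<Sum>j\<in>J. w x j * exp (l * (c k x j - p k x))) \<le> exp (l\<^sup>2)"
      unfolding p_def using insert.prems by (intro centred_exp_mean_le assms(2)) auto
  qed (simp add: A_def)
  also have "\<dots> = (\<Sum>k\<in>K. A k) * exp (l\<^sup>2)" by (simp add: sum_distrib_right)
  also have "\<dots> \<le> (card K * exp (l\<^sup>2 * card F)) * exp (l\<^sup>2)"
    using f(2) by (intro mult_right_mono) (auto simp: A_def)
  also have "\<dots> = card K * exp (l\<^sup>2 * card (insert x F))"
    using insert.hyps by (simp add: distrib_left exp_add)
  finally have "(\<Sum>k\<in>K. exp (l * (\<Sum>i\<in>insert x F. c k i ((f(x := j)) i) - p k i)))
    \<le> card K * exp (l\<^sup>2 * card (insert x F))" .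
  then show ?case unfolding p_def using f(1) j(1) by (intro exI[of _ "f(x := j)"]) auto
qed

text \<open>A Chernoff bound with a union bound over \<open>K\<close>. After sparsification at most
  \<open>card K\<close> coordinates are random, so the exponent involves \<open>card K\<close> in
  place of \<open>card I\<close>. Each exponential is at most the sum of all of them, which
  \<open>small\<close> keeps below \<open>exp (l * r)\<close>.\<close>

lemma rounding_with_small_deviation:
  fixes w :: "'i \<Rightarrow> 'j \<Rightarrow> real" and c :: "'k \<Rightarrow> 'i \<Rightarrow> 'j \<Rightarrow> real" and l r :: real
  assumes fin: "finite I" "finite J" "finite K"
    and nonneg: "\<And>i j. i \<in> I \<Longrightarrow> j \<in> J \<Longrightarrow> w i j \<ge> 0"
    and total: "\<And>i. i \<in> I \<Longrightarrow> (\<Sum>j\<in>J. w i j) = 1"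
    and c: "\<And>k i j. k \<in> K \<Longrightarrow> i \<in> I \<Longrightarrow> j \<in> J \<Longrightarrow> 0 \<le> c k i j \<and> c k i j \<le> 1"
    and "l > 0" and small: "card K * exp (l\<^sup>2 * card K) < exp (l * r)"
  obtains f where "\<And>i. i \<in> I \<Longrightarrow> f i \<in> J"
    and "\<And>k. k \<in> K \<Longrightarrow> (\<Sum>i\<in>I. c k i (f i)) < (\<Sum>i\<in>I. \<Sum>j\<in>J. c k i j * w i j) + r"
proof -
  obtain w' where w': "\<And>i j. i \<in> I \<Longrightarrow> j \<in> J \<Longrightarrow> w' i j \<ge> 0"
    "\<And>i. i \<in> I \<Longrightarrow> (\<Sum>j\<in>J. w' i j) = 1"
    "\<And>k. k \<in> K \<Longrightarrow> (\<Sum>i\<in>I. \<Sum>j\<in>J. c k i j * w' i j) = (\<Sum>i\<in>I. \<Sum>j\<in>J. c k i j * w i j)"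
    "card {i\<in>I. \<forall>j\<in>J. w' i j \<noteq> 1} \<le> card K"
    using sparse_randomisation[of I J K w c, OF fin nonneg total] by blast
  define F where "F = {i\<in>I. \<forall>j\<in>J. w' i j \<noteq> 1}"
  have FI: "F \<subseteq> I" "finite F" using fin by (auto simp: F_def)
  define p where "p = (\<lambda>k i. \<Sum>j\<in>J. c k i j * w' i j)"
  obtain f where f: "\<forall>i\<in>F. f i \<in> J"
    "(\<Sum>k\<in>K. exp (l * (\<Sum>i\<in>F. c k i (f i) - p k i))) \<le> card K * exp (l\<^sup>2 * card F)"
    using derandomised_exp_moment[of F J K w' c l] FI fin w' c unfolding p_def by blast
  obtain g where g: "\<And>i. i \<in> I - F \<Longrightarrow> g i \<in> J \<and> w' i (g i) = 1"
    unfolding F_def by (atomize_elim, intro choice) auto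
  define h where "h = (\<lambda>i. if i \<in> F then f i else g i)"
  \<comment> \<open>Where a row has an entry 1 the other entries vanish, so choosing that entry
    causes no deviation.\<close>
  have integral: "c k i (h i) = p k i" if "i \<in> I - F" for k i
  proof -
    have gi: "g i \<in> J" "w' i (g i) = 1" using g[OF that] by auto
    have "(\<Sum>j\<in>J - {g i}. w' i j) = 0"
      using w'(2)[of i] that gi fin by (simp add: sum.remove[of J "g i"])
    then have "\<forall>j\<in>J - {g i}. w' i j = 0"
      using fin w'(1) that by (subst (asm) sum_nonneg_eq_0_iff) auto
    then have "(\<Sum>j\<in>J - {g i}. c k i j * w' i j) = 0" by simp
    then have "p k i = c k i (g i)"
      unfolding p_def using gi fin by (simp add: sum.remove[of J "g i"])
    then show ?thesis using that by (simp add: h_def)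
  qed
  have "(\<Sum>i\<in>I. c k i (h i)) < (\<Sum>i\<in>I. \<Sum>j\<in>J. c k i j * w i j) + r" if k: "k \<in> K" for k
  proof -
    have "(\<Sum>i\<in>I. c k i (h i)) - (\<Sum>i\<in>I. p k i) = (\<Sum>i\<in>I. c k i (h i) - p k i)"
      by (simp add: sum_subtractf)
    also have "\<dots> = (\<Sum>i\<in>F. c k i (h i) - p k i)"
      using fin FI integral by (intro sum.mono_neutral_right) auto
    also have "\<dots> = (\<Sum>i\<in>F. c k i (f i) - p k i)" by (simp add: h_def)
    finally have dev: "(\<Sum>i\<in>I. c k i (h i)) - (\<Sum>i\<in>I. p k i) = (\<Sum>i\<in>F. c k i (f i) - p k i)" .
    have "exp (l * (\<Sum>i\<in>F. c k i (f i) - p k i)) \<le> (\<Sum>k\<in>K. exp (l * (\<Sum>i\<in>F. c k i (f i) - p k i)))"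
      using fin k by (intro member_le_sum) auto
    also note f(2)
    also have "card K * exp (l\<^sup>2 * card F) \<le> card K * exp (l\<^sup>2 * card K)"
      using w'(4) by (intro mult_left_mono) (auto simp: F_def intro!: mult_left_mono)
    also note small
    finally have "(\<Sum>i\<in>F. c k i (f i) - p k i) < r" using \<open>l > 0\<close> by simp
    with dev w'(3)[OF k] show ?thesis by (simp add: p_def)
  qed
  moreover have "h i \<in> J" if "i \<in> I" for i using that f(1) g by (auto simp: h_def)
  ultimately show ?thesis using that by blast
qed

section \<open>Hamming distance and maximal sets\<close>

lemma hdist_le_hdiam: "a \<in> S \<Longrightarrow> b \<in> S \<Longrightarrow> hdist a b \<le> hdiam S"
  unfolding hdiam_def by (rule SUP_upper2[of "(a, b)"]) auto

lemma hdist_commute: "hdist a b = hdist b a"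
  by (simp add: hdist_def eq_commute)

lemma hdist_le_enat_iff:
  "hdist a b \<le> enat k \<longleftrightarrow> finite {i. a i \<noteq> b i} \<and> card {i. a i \<noteq> b i} \<le> k"
  by (simp add: hdist_def)

text \<open>Adjoining such an \<open>x\<close> leaves the diameter equal to \<open>d\<close>, so
  maximality forces \<open>insert x S = S\<close>.\<close>

lemma d_maximal_mem:
  assumes "d_maximal n d S" "x \<in> seqs n" "\<And>s. s \<in> S \<Longrightarrow> hdist x s \<le> enat d"
  shows "x \<in> S"
proof -
  have S: "S \<subseteq> seqs n" "hdiam S = enat d"
    and max: "\<And>T. T \<subseteq> seqs n \<Longrightarrow> hdiam T = enat d \<Longrightarrow> S \<subseteq> T \<Longrightarrow> T = S"
    using assms(1) by (auto simp: d_maximal_def)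
  have "hdist a b \<le> enat d" if "a \<in> insert x S" "b \<in> insert x S" for a b
  proof (cases "a \<in> S \<and> b \<in> S")
    case True
    then show ?thesis using hdist_le_hdiam[of a S b] S by simp
  next
    case False
    have "hdist x x \<le> enat d" by (simp add: hdist_le_enat_iff)
    with False that assms(3) hdist_commute[of a x] show ?thesis by auto
  qed
  then have "hdiam (insert x S) \<le> enat d" unfolding hdiam_def by (intro SUP_least) auto
  moreover have "hdiam S \<le> hdiam (insert x S)"
    unfolding hdiam_def by (intro SUP_subset_mono) auto
  ultimately have "insert x S = S" using S assms(2) by (intro max) auto
  then show ?thesis by blast
qed

text \<open>A point at distance less than \<open>d\<close> from all of \<open>S\<close> can be altered in one of the infinitely many
  coordinates on which \<open>S\<close> is constant, and the result violates maximality.\<close>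

lemma d_maximal_no_near_centre:
  assumes max: "d_maximal n d S" and fin: "finite S" and "d \<ge> 1" and x: "x \<in> seqs n"
  shows "\<exists>s\<in>S. \<not> hdist x s < enat d"
proof (rule ccontr)
  assume "\<not> ?thesis"
  then have near: "\<And>s. s \<in> S \<Longrightarrow> hdist x s < enat d" by auto
  have diam: "hdiam S = enat d" and sub: "S \<subseteq> seqs n" using max by (auto simp: d_maximal_def)
  \<comment> \<open>Positive diameter gives two distinct points, hence at least two letters, so that
    a coordinate can be changed at all.\<close>
  have pair: "\<exists>a\<in>S. \<exists>b\<in>S. a \<noteq> b"
  proof (rule ccontr)
    assume "\<not> ?thesis"
    then have "hdiam S \<le> 0" unfolding hdiam_def
      by (intro SUP_least) (auto simp: hdist_def zero_enat_def)
    then show False using diam \<open>d \<ge> 1\<close> by (simp add: zero_enat_def)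
  qed
  then obtain a b i where ab: "a \<in> S" "b \<in> S" "a i \<noteq> b i" by blast
  then have "a i \<in> {1..n}" "b i \<in> {1..n}" using sub by (auto simp: seqs_def)
  then have n: "n \<ge> 2" using ab(3) by auto
  have "finite {i. x i \<noteq> s i}" if "s \<in> S" for s
    using near[OF that] by (auto simp: hdist_def split: if_splits)
  then have "finite (\<Union>s\<in>S. {i. x i \<noteq> s i})" using fin by blast
  then obtain j where j: "j \<notin> (\<Union>s\<in>S. {i. x i \<noteq> s i})"
    using ex_new_if_finite[OF infinite_UNIV_nat] by blast
  define v where "v = (if x j = 1 then 2 else 1 :: nat)"
  define y where "y = x(j := v)"
  have "v \<noteq> x j" "v \<in> {1..n}" using n by (auto simp: v_def)
  then have "y \<in> seqs n" using x by (auto simp: y_def seqs_def)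
  moreover have "hdist y s \<le> enat d" if "s \<in> S" for s
  proof -
    have fs: "finite {i. x i \<noteq> s i}" "card {i. x i \<noteq> s i} < d"
      using near[OF that] by (auto simp: hdist_def split: if_splits)
    have "{i. y i \<noteq> s i} \<subseteq> insert j {i. x i \<noteq> s i}" by (auto simp: y_def)
    then have "finite {i. y i \<noteq> s i}" "card {i. y i \<noteq> s i} \<le> card (insert j {i. x i \<noteq> s i})"
      using fs by (auto intro: finite_subset card_mono)
    moreover have "card (insert j {i. x i \<noteq> s i}) \<le> Suc (card {i. x i \<noteq> s i})"
      by (rule card_insert_le_m1) auto
    ultimately show ?thesis using fs by (simp add: hdist_le_enat_iff)
  qed
  ultimately have "y \<in> S" by (rule d_maximal_mem[OF max])
  \<comment> \<open>The coordinate \<open>j\<close> was chosen so that \<open>x\<close> agrees there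
    with every element of \<open>S\<close>, which now includes \<open>y\<close>.\<close>
  then have "x j = y j" using j by auto
  then show False using \<open>v \<noteq> x j\<close> by (simp add: y_def)
qed

text \<open>If the inequality failed, rounding the uniform distribution on \<open>S\<close> with
  allowance \<open>d / card S\<close> would give a point at distance less than \<open>d\<close> from
  all of \<open>S\<close>.\<close>

lemma d_maximal_moment_bound:
  fixes l :: real
  assumes max: "d_maximal n d S" and fin: "finite S" and d: "d \<ge> 1" and "l > 0"
  shows "exp (l * (d / card S)) \<le> card S * exp (l\<^sup>2 * card S)"
proof (rule ccontr)
  assume "\<not> ?thesis"
  then have small: "card S * exp (l\<^sup>2 * card S) < exp (l * (d / card S))" by simp
  define m where "m = card S"
  have diam: "hdiam S = enat d" and sub: "S \<subseteq> seqs n" using max by (auto simp: d_maximal_def)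
  \<comment> \<open>The supremum over the empty set is 0 in \<open>enat\<close>, which differs from
    \<open>d\<close>.\<close>
  have "S \<noteq> {}" using diam d by (auto simp: hdiam_def bot_enat_def zero_enat_def)
  then obtain s0 where s0: "s0 \<in> S" by blast
  have m: "m > 0" using \<open>S \<noteq> {}\<close> fin by (simp add: m_def card_gt_0_iff)
  have dist: "finite {i. a i \<noteq> b i}" "card {i. a i \<noteq> b i} \<le> d" if "a \<in> S" "b \<in> S" for a b
    using hdist_le_hdiam[OF that] diam by (auto simp: hdist_le_enat_iff)
  \<comment> \<open>The coordinates on which \<open>S\<close> is not constant: a finite union of
    finite sets, and the only ones that have to be rounded.\<close>
  define I where "I = (\<Union>a\<in>S. \<Union>b\<in>S. {i. a i \<noteq> b i})"
  have finI: "finite I" unfolding I_def using fin dist by blast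
  have hcard: "(\<Sum>i\<in>I. of_bool (a i \<noteq> s i)) = real (card {i\<in>I. a i \<noteq> s i})" for a s :: "nat \<Rightarrow> nat"
    using finI by (simp add: Int_def)
  \<comment> \<open>The gain \<open>d / m\<close> comes from \<open>t = s\<close>, which contributes
    distance 0, while each of the other \<open>m - 1\<close> elements contributes at most
    \<open>d\<close>.\<close>
  have mean: "(\<Sum>i\<in>I. \<Sum>t\<in>S. of_bool (t i \<noteq> s i) * (1 / real m)) + d / real m \<le> d" if s: "s \<in> S" for s
  proof -
    have "(\<Sum>i\<in>I. \<Sum>t\<in>S. of_bool (t i \<noteq> s i) * (1 / real m))
        = (\<Sum>t\<in>S. real (card {i\<in>I. t i \<noteq> s i})) / m"
      by (subst sum.swap) (simp add: hcard flip: sum_divide_distrib)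
    also have "(\<Sum>t\<in>S. real (card {i\<in>I. t i \<noteq> s i})) = (\<Sum>t\<in>S - {s}. real (card {i\<in>I. t i \<noteq> s i}))"
      using fin s by (simp add: sum.remove[of S s])
    also have "\<dots> \<le> (\<Sum>t\<in>S - {s}. real d)"
    proof (intro sum_mono)
      fix t assume "t \<in> S - {s}"
      then have "card {i\<in>I. t i \<noteq> s i} \<le> card {i. t i \<noteq> s i}" "card {i. t i \<noteq> s i} \<le> d"
        using dist[of t s] s by (auto intro: card_mono)
      then show "real (card {i\<in>I. t i \<noteq> s i}) \<le> real d" by linarith
    qed
    also have "\<dots> = (real m - 1) * d" using fin s m by (simp add: m_def of_nat_diff)
    finally have "(\<Sum>i\<in>I. \<Sum>t\<in>S. of_bool (t i \<noteq> s i) * (1 / real m)) \<le> (real m - 1) * d / m"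
      using m by (simp add: divide_right_mono)
    then show ?thesis using m by (simp add: field_simps)
  qed
  obtain f where f: "\<And>i. i \<in> I \<Longrightarrow> f i \<in> S"
    "\<And>s. s \<in> S \<Longrightarrow> (\<Sum>i\<in>I. of_bool (f i i \<noteq> s i))
       < (\<Sum>i\<in>I. \<Sum>t\<in>S. of_bool (t i \<noteq> s i) * (1 / real m)) + d / real m"
    by (rule rounding_with_small_deviation[where I = I and J = S and K = S and l = l
        and r = "d / real m" and w = "\<lambda>_ _. 1 / real m" and c = "\<lambda>s i t. of_bool (t i \<noteq> s i)"])
      (use finI fin m small \<open>l > 0\<close> in \<open>auto simp: m_def\<close>)
  \<comment> \<open>Off \<open>I\<close> all elements of \<open>S\<close> coincide with
    \<open>s0\<close>, so \<open>x\<close> differs from them only inside \<open>I\<close>.\<close>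
  define x where "x = (\<lambda>i. if i \<in> I then f i i else s0 i)"
  have "x i \<in> {1..n}" for i
  proof -
    have "(if i \<in> I then f i else s0) \<in> seqs n" using f(1) s0 sub by auto
    then show ?thesis by (auto simp: x_def seqs_def split: if_splits)
  qed
  then have "x \<in> seqs n" by (simp add: seqs_def)
  moreover have "hdist x s < enat d" if s: "s \<in> S" for s
  proof -
    have "s0 i = s i" if "i \<notin> I" for i using that s s0 by (auto simp: I_def)
    then have eq: "{i. x i \<noteq> s i} = {i\<in>I. f i i \<noteq> s i}" by (auto simp: x_def)
    have "real (card {i\<in>I. f i i \<noteq> s i}) = (\<Sum>i\<in>I. of_bool (f i i \<noteq> s i))"
      using finI by (simp add: Int_def)
    also have "\<dots> < d" using f(2)[OF s] mean[OF s] by linarith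
    finally show ?thesis unfolding hdist_def eq using finI by simp
  qed
  ultimately show False using d_maximal_no_near_centre[OF max fin d] by blast
qed

section \<open>Choice of the exponential parameter and numerical estimates\<close>

theorem theorem6:
  fixes n d :: nat and S :: "(nat \<Rightarrow> nat) set"
  assumes "n \<ge> 1" and "d \<ge> 1"
    and "d_maximal n d S"
  shows "infinite S \<or> real (card S) \<ge> 1 / 2 * (real d / ln (2 * real d)) powr (2 / 3)"
proof (rule ccontr)
  assume "\<not> ?thesis"
  then have fin: "finite S" and lt: "2 * real (card S) < (real d / ln (2 * real d)) powr (2 / 3)"
    by auto
  define m L where "m = real (card S)" and "L = ln (2 * real d)"
  have "S \<noteq> {}" using assms by (auto simp: d_maximal_def hdiam_def bot_enat_def zero_enat_def)
  then have m: "m \<ge> 1" using fin by (simp add: m_def Suc_le_eq card_gt_0_iff)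
  have ln2: "ln (2::real) \<ge> 1/2"
    using ln_le_minus_one[of "1/2::real"] by (simp add: ln_div)
  have L_eq: "L = ln 2 + ln d" unfolding L_def using assms by (simp add: ln_mult)
  have lnd: "ln (real d) \<ge> 0" using assms by simp
  have L: "L \<ge> 1/2" using ln2 lnd L_eq by linarith
  \<comment> \<open>Cubing the assumed bound turns the exponent 2/3 into a square and gives
    \<open>key\<close>.\<close>
  have "(2 * m)\<^sup>2 * (2 * m) = (2 * m) powr 3" using m by (simp add: powr_numeral power3_eq_cube power2_eq_square)
  also have "\<dots> < ((d / L) powr (2/3)) powr 3"
    using lt m by (intro powr_less_mono2) (auto simp: m_def L_def)
  also have "\<dots> = (d / L)\<^sup>2" using assms L by (simp add: powr_powr powr_numeral)
  finally have "8 * m^3 < d\<^sup>2 / L\<^sup>2" by (simp add: power_divide power2_eq_square power3_eq_cube)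
  then have key: "8 * m^3 * L\<^sup>2 < d\<^sup>2" using L by (simp add: field_simps)
  have L2: "L\<^sup>2 \<ge> 1/2 * L" using L by (simp add: power2_eq_square)
  \<comment> \<open>Since \<open>L \<ge> 1/2\<close>, the bound \<open>key\<close> already yields
    \<open>m < d\<close>; this crude estimate serves to replace \<open>ln m\<close> by
    \<open>ln d \<le> L \<le> 2 * L\<^sup>2\<close>.\<close>
  have "m^3 * 1 \<le> m^3 * (8 * L\<^sup>2)" using L L2 m by (intro mult_left_mono) auto
  then have "m^3 < d\<^sup>2" using key by (simp add: mult_ac)
  moreover have "m\<^sup>2 * 1 \<le> m\<^sup>2 * m" using m by (intro mult_left_mono) auto
  ultimately have "m\<^sup>2 < d\<^sup>2" by (simp add: power2_eq_square power3_eq_cube)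
  then have "m < d" using power_less_imp_less_base by fastforce
  then have "ln m < ln d" using m by simp
  also have "\<dots> \<le> 2 * L\<^sup>2" using L2 L_eq ln2 by linarith
  also have "\<dots> < d\<^sup>2 / (4 * m^3)" using key m by (simp add: field_simps)
  finally have ln_m: "ln m < d\<^sup>2 / (4 * m^3)" .
  \<comment> \<open>The maximiser of \<open>l * (d / m) - l\<^sup>2 * m\<close>; the maximum
    \<open>d\<^sup>2 / (4 * m^3)\<close> is exactly the quantity shown to exceed
    \<open>ln m\<close>.\<close>
  define l where "l = d / (2 * m\<^sup>2)"
  have "l > 0" using assms m by (simp add: l_def)
  then have "exp (l * (d / m)) \<le> m * exp (l\<^sup>2 * m)"
    using d_maximal_moment_bound[OF assms(3) fin assms(2)] by (simp add: m_def)
  also have "\<dots> = exp (ln m + l\<^sup>2 * m)" using m by (simp add: exp_add)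
  finally have "l * (d / m) \<le> ln m + l\<^sup>2 * m" by simp
  moreover have "l * (d / m) = 2 * (d\<^sup>2 / (4 * m^3))" "l\<^sup>2 * m = d\<^sup>2 / (4 * m^3)"
    using m by (simp_all add: l_def field_simps power2_eq_square power3_eq_cube)
  ultimately show False using ln_m by linarith
qed

end
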